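(* Let $D\le 41$ be a fundamental discriminant ($D>1$) with $D\not\equiv 1\bmod 8$ and $D\ne 21$, i.e. $D\in\{5,8,12,13,24,28,29,37,40\}$. Then the cuspidal polynomial $c_D(t)$ is in $\mathbb Z[t]$, and a prime $p$ divides the discriminant of $c_D(t)$ only if $p$ divides \[ N(D)=2\cdot D\cdot\prod_{e}\frac{D-e^2}{4},\qquad e\text{ ranging over } \{e: e>0,\ e\equiv D\bmod 2,\ e^2<D\}. \]
   Context: For an integer $D>0$ with $D\equiv 0,1 \bmod 4$, $\mathcal O_D=\mathbb Z[\frac{D+\sqrt D}{2}]$ is the quadratic ring of discriminant $D$; $D$ is fundamental if $\mathcal O_D$ is a maximal order. For a compact Riemann surface $X$ of genus two, $\mathrm{Jac}(X)$ admits real multiplication by $\mathcal O_D$ if there is an injective ring homomorphism $\iota:\mathcal O_D\to\mathrm{End}(\mathrm{Jac}(X))$ which is proper (does not extend to a larger subring of $\mathcal O_D\otimes\mathbb Q$) and self-adjoint for the Rosati involution. The Weierstrass curve $W_D$ is the moduli space of pairs $(X,[\omega])$ where $X$ is a Riemann surface of genus two, $\omega$ is a holomorphic one-form on $X$ with a double zero, $[\omega]$ is its class up to scale, and $\mathrm{Jac}(X)$ admits real multiplication by $\mathcal O_D$ stabilizing $\omega$ up to scale. $\overline W_D$ is the smooth projective curve birational to $W_D$, obtained from $W_D$ by smoothing finitely many orbifold points and filling in finitely many cusps; the filled-in points are called the cusps of $\overline W_D$. For the discriminants $D$ in the claim, $\overline W_D$ is biregular to $\mathbb P^1$ over $\mathbb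 Q$, and it is identified with the projective $t$-line by a fixed explicit parametrization over $\mathbb Q$ (supplied by the authors in computer files). The cuspidal polynomial $c_D(t)$ is the monic polynomial vanishing simply at the cusps of $\overline W_D$ in the affine $t$-line and nowhere else. For the fixed parametrizations, the cuspidal polynomials are \[ \begin{aligned} c_5&=t-4,\qquad c_8=t(t+1),\qquad c_{12}=t^2+10t+13,\qquad c_{13}=t(t^2-14t-3),\\ c_{24}&=t(t-16)(t^2-6)(t^2-24t-72),\\ c_{28}&=(t^2-24t-423)(t^2-63)(t^2+14t+21),\\ c_{29}&=t(t^2-174t+145)(t^2+145t-3625),\\ c_{37}&=(t^2-2368)(t^2-1332)(t^2+74t+1221)(t^3+51t^2-2220t-114108),\\ c_{40}&=t(t+81)(t^2+110t+2025)(t^2+270t-10935)(t^2+630t+18225)(t^3+351t^2+10935t+164025). \end{aligned} \] (The discriminant of a polynomial of degree one is $1$.) *)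

theory Defs
  imports
    "Subresultants.Resultant_Prelim"
    "HOL-Algebra.Generated_Groups"
    "HOL-Algebra.Generated_Rings"
    "HOL-Number_Theory.Cong"
begin

(* The Q-algebra Q[x]/(x^2 - D), with the pair (a, b) standing for a + b sqrt D.  The square root
   is adjoined formally, so that for a square D > 0 this is Q x Q and not Q; in particular
   square discriminants are treated correctly below. *)
definition quad_alg :: "int \<Rightarrow> (rat \<times> rat) ring" where
  "quad_alg D = \<lparr>carrier = UNIV,
     monoid.mult = (\<lambda>x y. (fst x * fst y + of_int D * (snd x * snd y), fst x * snd y + snd x * fst y)),
     one = (1, 0),
     zero = (0, 0),
     add = (\<lambda>x y. (fst x + fst y, snd x + snd y))\<rparr>"

(* Z[(D + sqrt D)/2] *)
definition quad_order :: "int \<Rightarrow> (rat \<times> rat) set" where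
  "quad_order D = generate_ring (quad_alg D) {(of_int D / 2, 1 / 2)}"

(* Orders of a Q-algebra K: unital subrings that are finitely generated as abelian groups and
   span K over Q (every element of K has a positive integer multiple in the subring). *)
definition is_order :: "'a ring \<Rightarrow> 'a set \<Rightarrow> bool" where
  "is_order K R \<longleftrightarrow>
     subring R K \<and>
     (\<exists>B. finite B \<and> B \<subseteq> R \<and> R = generate (add_monoid K) B) \<and>
     (\<forall>x\<in>carrier K. \<exists>n::nat. n > 0 \<and> add_pow K n x \<in> R)"

definition is_maximal_order :: "'a ring \<Rightarrow> 'a set \<Rightarrow> bool" where
  "is_maximal_order K R \<longleftrightarrow> is_order K R \<and> (\<forall>S. is_order K S \<and> R \<subseteq> S \<longrightarrow> S = R)"

definition discriminant :: "int \<Rightarrow> bool" where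
  "discriminant D \<longleftrightarrow> D > 0 \<and> ([D = 0] (mod 4) \<or> [D = 1] (mod 4))"

definition fundamental_discriminant :: "int \<Rightarrow> bool" where
  "fundamental_discriminant D \<longleftrightarrow> discriminant D \<and> is_maximal_order (quad_alg D) (quad_order D)"

(* The monic polynomial with simple zeros exactly at the cusps of the smooth completion of the
   Weierstrass curve W_D, in the coordinate t of a fixed rational parametrization of that curve.
   As the parametrization is given only by explicit data, so is the polynomial.  No value is
   specified for other D. *)
definition cuspidal_poly :: "int \<Rightarrow> complex poly" where
  "cuspidal_poly D = (let t = [:0, 1:] in
     if D = 5 then t - 4
     else if D = 8 then t * (t + 1)
     else if D = 12 then t^2 + 10 * t + 13
     else if D = 13 then t * (t^2 - 14 * t - 3)
     else if D = 24 then t * (t - 16) * (t^2 - 6) * (t^2 - 24 * t - 72)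
     else if D = 28 then (t^2 - 24 * t - 423) * (t^2 - 63) * (t^2 + 14 * t + 21)
     else if D = 29 then t * (t^2 - 174 * t + 145) * (t^2 + 145 * t - 3625)
     else if D = 37 then
       (t^2 - 2368) * (t^2 - 1332) * (t^2 + 74 * t + 1221) * (t^3 + 51 * t^2 - 2220 * t - 114108)
     else if D = 40 then
       t * (t + 81) * (t^2 + 110 * t + 2025) * (t^2 + 270 * t - 10935) * (t^2 + 630 * t + 18225) *
       (t^3 + 351 * t^2 + 10935 * t + 164025)
     else undefined)"

(* The division is exact; in degree one the value is 1. *)
definition poly_discriminant :: "int poly \<Rightarrow> int" where
  "poly_discriminant f =
     ((-1) ^ (degree f * (degree f - 1) div 2) * resultant f (pderiv f)) div lead_coeff f"

(* For a discriminant D the divisions by 4 are exact: e = D (mod 2) implies e^2 = D (mod 4). *)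
definition N :: "int \<Rightarrow> int" where
  "N D = 2 * D * (\<Prod>e | e > 0 \<and> [e = D] (mod 2) \<and> e\<^sup>2 < D. (D - e\<^sup>2) div 4)"

end

(* The claim on discriminants: an order of Q[x]/(x^2 - D) has bounded denominators, so the norms of its
   elements, having powers of bounded denominator, are integers; applying this to 1 + x shows that
   traces are integers too, which leaves no room above O_D when D is squarefree up to a factor 4.
   For D = 4 E with E a discriminant, O_E is a strictly larger order.

   The claim on primes: if the ideal (f, f') of Z[t] contains a power of N, then multiplying the
   Sylvester matrix of f and f' by a matrix of Bezout coefficients gives a power of N times the
   identity, so the discriminant of f divides a power of N.  This comaximality up to powers of N is
   multiplicative, so for c_D it reduces to the irreducible factors: each is comaximal
   with its derivative, and any two of them are comaximal. *)
theory Submission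
  imports Defs "HOL-Computational_Algebra.Squarefree"
begin

hide_const (open) up_ring.monom up_ring.coeff

subsection \<open>Fundamental discriminants\<close>

lemma rat_multiple_Ints:
  obtains n :: nat where "n > 0" "of_nat n * (q :: rat) \<in> \<int>"
proof (cases q)
  case (Fract a b)
  then have "of_nat (nat b) * q = of_int a"
    by (simp add: Fract_of_int_quotient)
  with Fract(2) show ?thesis by (intro that[of "nat b"]) auto
qed

text \<open>In lowest terms q = a/b, every power of b divides n; exponent |n| rules out b >= 2
  because 2^|n| > |n|.\<close>

lemma rat_Ints_if_bounded_powers:
  fixes q :: rat and n :: int
  assumes "n \<noteq> 0" and int: "\<And>k. of_int n * q ^ k \<in> \<int>"
  shows "q \<in> \<int>"
proof (cases q)
  case (Fract a b)
  have dvd: "b ^ k dvd n" for k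
  proof -
    obtain c where "of_int n * q ^ k = of_int c"
      using int[of k] by (elim Ints_cases)
    then have "of_int n * of_int a ^ k = (of_int c * of_int b ^ k :: rat)"
      using Fract by (simp add: Fract_of_int_quotient field_simps)
    then have "of_int (n * a ^ k) = (of_int (c * b ^ k) :: rat)"
      by simp
    then have "n * a ^ k = c * b ^ k"
      by (simp only: of_int_eq_iff)
    then have "b ^ k dvd n * a ^ k" by simp
    moreover have "coprime (b ^ k) (a ^ k)"
      using Fract(3) by (simp add: coprime_commute)
    ultimately show ?thesis by (simp add: coprime_dvd_mult_left_iff)
  qed
  have "b = 1"
  proof (rule ccontr)
    assume "b \<noteq> 1"
    with Fract(2) have "b \<ge> 2" by linarith
    have "int (nat \<bar>n\<bar>) < 2 ^ nat \<bar>n\<bar>"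
      using of_nat_less_two_power by blast
    also have "\<dots> \<le> b ^ nat \<bar>n\<bar>"
      using \<open>b \<ge> 2\<close> by (intro power_mono) auto
    also have "\<dots> \<le> \<bar>n\<bar>"
      using dvd[of "nat \<bar>n\<bar>"] assms(1) by (intro zdvd_imp_le) auto
    finally show False by simp
  qed
  with Fract show ?thesis by (simp add: Fract_of_int_quotient)
qed

lemma rat_Ints_if_squarefree_mult_square:
  fixes q :: rat and m :: int
  assumes "squarefree m" and int: "of_int m * q\<^sup>2 \<in> \<int>"
  shows "q \<in> \<int>"
proof (cases q)
  case (Fract a b)
  obtain c where "of_int m * q\<^sup>2 = of_int c"
    using int by (elim Ints_cases)
  then have "of_int m * of_int a ^ 2 = (of_int c * of_int b ^ 2 :: rat)"
    using Fract by (simp add: Fract_of_int_quotient field_simps)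
  then have "of_int (m * a ^ 2) = (of_int (c * b ^ 2) :: rat)"
    by simp
  then have "m * a ^ 2 = c * b ^ 2"
    by (simp only: of_int_eq_iff)
  then have "b ^ 2 dvd m * a ^ 2" by simp
  moreover have "coprime (b ^ 2) (a ^ 2)"
    using Fract(3) by (simp add: coprime_commute)
  ultimately have "b ^ 2 dvd m" by (simp add: coprime_dvd_mult_left_iff)
  then have "b dvd 1" by (rule squarefreeD[OF assms(1)])
  with Fract(2) have "b = 1" by simp
  with Fract show ?thesis by (simp add: Fract_of_int_quotient)
qed

section \<open>The quadratic algebra and its lattices spanned by 1 and (E + sqrt E)/2\<close>

lemma quad_alg_simps [simp]:
  "carrier (quad_alg D) = UNIV"
  "x \<otimes>\<^bsub>quad_alg D\<^esub> y =
     (fst x * fst y + of_int D * (snd x * snd y), fst x * snd y + snd x * fst y)"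
  "\<one>\<^bsub>quad_alg D\<^esub> = (1, 0)"
  "\<zero>\<^bsub>quad_alg D\<^esub> = (0, 0)"
  "x \<oplus>\<^bsub>quad_alg D\<^esub> y = (fst x + fst y, snd x + snd y)"
  by (simp_all add: quad_alg_def)

lemma ring_quad_alg: "ring (quad_alg D)"
proof (rule ringI)
  show "abelian_group (quad_alg D)"
  proof (rule abelian_groupI)
    show "\<exists>y\<in>carrier (quad_alg D). y \<oplus>\<^bsub>quad_alg D\<^esub> x = \<zero>\<^bsub>quad_alg D\<^esub>" for x
      by (intro bexI[of _ "(- fst x, - snd x)"]) auto
  qed auto
  show "Group.monoid (quad_alg D)"
    by (rule monoidI) (auto simp: algebra_simps)
qed (auto simp: algebra_simps)

lemma quad_alg_uminus [simp]: "\<ominus>\<^bsub>quad_alg D\<^esub> x = (- fst x, - snd x)"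
proof -
  interpret ring "quad_alg D" by (rule ring_quad_alg)
  show ?thesis by (rule minus_equality) auto
qed

lemma quad_alg_add_pow: "add_pow (quad_alg D) n x = (of_nat n * fst x, of_nat n * snd x)"
proof -
  interpret ring "quad_alg D" by (rule ring_quad_alg)
  show ?thesis by (induction n) (auto simp: algebra_simps)
qed

(* For D * s^2 = E this is the order of discriminant E inside Q[x]/(x^2 - D), as s * sqrt D is a
   square root of E. *)
definition quad_lattice :: "int \<Rightarrow> rat \<Rightarrow> (rat \<times> rat) set" where
  "quad_lattice E s = {(of_int a + of_int b * of_int E / 2, of_int b * s / 2) | a b. True}"

lemma quad_latticeI:
  "x = of_int a + of_int b * of_int E / 2 \<Longrightarrow> y = of_int b * s / 2 \<Longrightarrow> (x, y) \<in> quad_lattice E s"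
  unfolding quad_lattice_def by blast

text \<open>Lattice elements are integer combinations of the two generators. Closure is assumed in
  coordinates so that H can be a generated additive group, a generated ring or another
  lattice.\<close>

lemma quad_lattice_subset:
  assumes add: "\<And>x y. x \<in> H \<Longrightarrow> y \<in> H \<Longrightarrow> (fst x + fst y, snd x + snd y) \<in> H"
    and neg: "\<And>x. x \<in> H \<Longrightarrow> (- fst x, - snd x) \<in> H"
    and gens: "(1, 0) \<in> H" "(of_int E / 2, s / 2) \<in> H"
  shows "quad_lattice E s \<subseteq> H"
proof -
  have mult: "(of_int k * fst x, of_int k * snd x) \<in> H" if x: "x \<in> H" for k x
  proof (induction k rule: int_induct[where k = 0])
    case base
    show ?case using add[OF x neg[OF x]] by simp
  next
    case (step1 i)
    then show ?case using add[OF step1(2) x] by (simp add: algebra_simps)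
  next
    case (step2 i)
    then show ?case using add[OF step2(2) neg[OF x]] by (simp add: algebra_simps)
  qed
  show ?thesis
    using add[OF mult[OF gens(1)] mult[OF gens(2)]] by (auto simp: quad_lattice_def)
qed

lemma discriminant_dvd: "discriminant E \<Longrightarrow> 4 dvd E * (E - 1)"
  unfolding discriminant_def cong_iff_dvd_diff by auto

text \<open>For w = (E + sqrt E)/2 one has w^2 = E w - E (E - 1)/4, and the last term is an integer
  for a discriminant E; it is the \<open>c\<close> of the proof.\<close>

lemma subring_quad_lattice:
  assumes "discriminant E" "of_int D * s\<^sup>2 = of_int E"
  shows "subring (quad_lattice E s) (quad_alg D)"
proof -
  interpret ring "quad_alg D" by (rule ring_quad_alg)
  obtain c where "E * (E - 1) = 4 * c"
    using discriminant_dvd[OF assms(1)] by blast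
  then have "(of_int (E * (E - 1)) :: rat) = of_int (4 * c)" by (rule arg_cong)
  then have c: "of_int E * of_int E = (4 * of_int c + of_int E :: rat)"
    by (simp add: algebra_simps)
  have s: "of_int D * (s * s) = of_int E"
    using assms(2) by (simp add: power2_eq_square)
  have mult: "(x \<otimes>\<^bsub>quad_alg D\<^esub> y) \<in> quad_lattice E s"
    if xy: "x \<in> quad_lattice E s" "y \<in> quad_lattice E s" for x y
  proof -
    obtain a b where x: "x = (of_int a + of_int b * of_int E / 2, of_int b * s / 2)"
      using xy(1) unfolding quad_lattice_def by blast
    obtain a' b' where y: "y = (of_int a' + of_int b' * of_int E / 2, of_int b' * s / 2)"
      using xy(2) unfolding quad_lattice_def by blast
    have "fst x * fst y + of_int D * (snd x * snd y) =
      of_int a * of_int a' + (of_int a * of_int b' + of_int a' * of_int b) * of_int E / 2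
      + of_int b * of_int b' * (of_int E * of_int E) / 4 + of_int b * of_int b' * (of_int D * (s * s)) / 4"
      by (simp add: x y field_simps)
    also have "\<dots> = of_int (a * a' - b * b' * c)
      + of_int (a * b' + a' * b) * of_int E / 2 + of_int b * of_int b' * (of_int E * of_int E) / 2"
      unfolding s c by (simp add: field_simps)
    also have "\<dots> = of_int (a * a' - b * b' * c)
      + of_int (a * b' + a' * b + b * b' * E) * of_int E / 2"
      by (simp add: field_simps)
    finally have "fst (x \<otimes>\<^bsub>quad_alg D\<^esub> y) = \<dots>" by simp
    moreover have "snd (x \<otimes>\<^bsub>quad_alg D\<^esub> y) = of_int (a * b' + a' * b + b * b' * E) * s / 2"
      by (simp add: x y field_simps)
    ultimately show ?thesis
      using quad_latticeI by (metis prod.collapse)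
  qed
  show ?thesis
  proof (rule subringI)
    show "\<one>\<^bsub>quad_alg D\<^esub> \<in> quad_lattice E s"
      by (auto intro!: quad_latticeI[of _ 1 0])
    fix x assume "x \<in> quad_lattice E s"
    then obtain a b where x: "x = (of_int a + of_int b * of_int E / 2, of_int b * s / 2)"
      unfolding quad_lattice_def by blast
    show "\<ominus>\<^bsub>quad_alg D\<^esub> x \<in> quad_lattice E s"
      by (auto simp: x intro!: quad_latticeI[of _ "- a" "- b"])
    fix y assume "y \<in> quad_lattice E s"
    then obtain a' b' where y: "y = (of_int a' + of_int b' * of_int E / 2, of_int b' * s / 2)"
      unfolding quad_lattice_def by blast
    show "x \<oplus>\<^bsub>quad_alg D\<^esub> y \<in> quad_lattice E s"
      unfolding quad_alg_simps
      by (rule quad_latticeI[of _ "a + a'" "b + b'"]) (simp_all add: x y field_simps)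
  qed (use mult in auto)
qed

lemma quad_lattice_gens: "(1, 0) \<in> quad_lattice E s" "(of_int E / 2, s / 2) \<in> quad_lattice E s"
  by (rule quad_latticeI[of _ 1 0] quad_latticeI[of _ 0 1], simp_all)+

lemma is_order_quad_lattice:
  assumes "discriminant E" "of_int D * s\<^sup>2 = of_int E"
  shows "is_order (quad_alg D) (quad_lattice E s)"
  unfolding is_order_def
proof (intro conjI ballI)
  interpret ring "quad_alg D" by (rule ring_quad_alg)
  let ?B = "{(1, 0), (of_int E / 2, s / 2)} :: (rat \<times> rat) set"
  let ?G = "generate (add_monoid (quad_alg D)) ?B"
  show sub: "subring (quad_lattice E s) (quad_alg D)"
    by (rule subring_quad_lattice[OF assms])
  have G: "subgroup ?G (add_monoid (quad_alg D))"
    by (rule add.generate_is_subgroup) simp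
  have "?G \<subseteq> quad_lattice E s"
    using subring.axioms(1)[OF sub]
    by (intro add.generate_subgroup_incl) (auto simp: quad_lattice_gens)
  moreover have "quad_lattice E s \<subseteq> ?G"
  proof (rule quad_lattice_subset)
    fix x y assume "x \<in> ?G" "y \<in> ?G"
    then show "(fst x + fst y, snd x + snd y) \<in> ?G"
      using subgroup.m_closed[OF G] by simp
  next
    fix x assume "x \<in> ?G"
    then show "(- fst x, - snd x) \<in> ?G"
      using subgroup.m_inv_closed[OF G, of x] by (simp only: a_inv_def[symmetric] quad_alg_uminus)
  qed (auto intro: generate.incl)
  ultimately have "quad_lattice E s = ?G" by (rule subset_antisym[rotated])
  then show "\<exists>B. finite B \<and> B \<subseteq> quad_lattice E s \<and>
      quad_lattice E s = generate (add_monoid (quad_alg D)) B"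
    using quad_lattice_gens[of E s] by (metis empty_subsetI finite.simps insert_subset)
  fix x :: "rat \<times> rat"
  have s: "s \<noteq> 0"
  proof
    assume "s = 0"
    with assms(2) have "E = 0" by simp
    with assms(1) show False by (simp add: discriminant_def)
  qed
  obtain n where n: "n > 0" "of_nat n * fst x \<in> \<int>" by (rule rat_multiple_Ints)
  obtain n' where n': "n' > 0" "of_nat n' * (2 * snd x / s) \<in> \<int>" by (rule rat_multiple_Ints)
  obtain a where a: "of_nat n * fst x = of_int a" using n(2) by (elim Ints_cases)
  obtain b where b: "of_nat n' * (2 * snd x / s) = of_int b" using n'(2) by (elim Ints_cases)
  have "of_nat (2 * n * n') * fst x =
      of_int (2 * int n' * a - int n * b * E) + of_int (2 * int n * b) * of_int E / 2"
    using a by (simp add: algebra_simps)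
  moreover have "of_nat (2 * n * n') * snd x = of_int (2 * int n * b) * s / 2"
    using b s by (simp add: field_simps)
  ultimately have "add_pow (quad_alg D) (2 * n * n') x \<in> quad_lattice E s"
    unfolding quad_alg_add_pow by (rule quad_latticeI)
  then show "\<exists>k::nat. k > 0 \<and> add_pow (quad_alg D) k x \<in> quad_lattice E s"
    using n(1) n'(1) by (intro exI[of _ "2 * n * n'"]) simp
qed

lemma quad_order_eq: "discriminant D \<Longrightarrow> quad_order D = quad_lattice D 1"
proof
  interpret ring "quad_alg D" by (rule ring_quad_alg)
  assume "discriminant D"
  then have "subring (quad_lattice D 1) (quad_alg D)"
    by (rule subring_quad_lattice) simp
  then show "quad_order D \<subseteq> quad_lattice D 1"
    unfolding quad_order_def
    by (intro generate_ring_min_subring1) (auto simp: quad_lattice_gens)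
  show "quad_lattice D 1 \<subseteq> quad_order D"
  proof (rule quad_lattice_subset)
    fix x y assume "x \<in> quad_order D" "y \<in> quad_order D"
    then show "(fst x + fst y, snd x + snd y) \<in> quad_order D"
      using generate_ring.eng_add[of x "quad_alg D" _ y] by (simp add: quad_order_def)
  next
    fix x assume "x \<in> quad_order D"
    then show "(- fst x, - snd x) \<in> quad_order D"
      using generate_ring.a_inv[of x "quad_alg D"] by (simp add: quad_order_def)
  next
    show "(1, 0) \<in> quad_order D"
      using generate_ring.one[of "quad_alg D"] by (simp add: quad_order_def)
  qed (auto simp: quad_order_def intro: generate_ring.incl)
qed

text \<open>As 4E * (1/2)^2 = E, the lattice \<open>?S\<close> is the order of discriminant E in the
  same algebra. It contains O_D for D = 4E, and strictly so: second coordinates in O_D are multiples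
  of 1/2, but (E/2, 1/4) lies in \<open>?S\<close>.\<close>

lemma not_fundamental_discriminant_4_mult:
  assumes "discriminant E"
  shows "\<not> fundamental_discriminant (4 * E)"
proof
  let ?K = "quad_alg (4 * E)" and ?S = "quad_lattice E (1/2)"
  interpret ring ?K by (rule ring_quad_alg)
  assume *: "fundamental_discriminant (4 * E)"
  then have eq: "quad_order (4 * E) = quad_lattice (4 * E) 1"
    by (intro quad_order_eq) (simp add: fundamental_discriminant_def)
  have S: "is_order ?K ?S"
    by (rule is_order_quad_lattice[OF assms]) (simp add: power2_eq_square)
  then have sub: "subring ?S ?K" by (simp add: is_order_def)
  have "quad_lattice (4 * E) 1 \<subseteq> ?S"
  proof (rule quad_lattice_subset)
    show "(of_int (4 * E) / 2, 1 / 2) \<in> ?S"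
      \<comment> \<open>(2E, 1/2) = E + 2 (E/2, 1/4).\<close>
      by (rule quad_latticeI[of _ E 2]) auto
  qed (use subringE(5,7)[OF sub] in \<open>auto simp: quad_lattice_gens\<close>)
  with * S have "?S = quad_lattice (4 * E) 1"
    by (simp add: fundamental_discriminant_def is_maximal_order_def eq)
  moreover have "(of_int E / 2, 1 / 4) \<in> ?S"
    using quad_lattice_gens(2)[of E "1/2"] by simp
  ultimately obtain b :: int where "1 / 4 = (of_int b / 2 :: rat)"
    by (auto simp: quad_lattice_def)
  then have "of_int (2 * b) = (of_int 1 :: rat)" by simp
  then have "2 * b = 1" unfolding of_int_eq_iff .
  then show False by presburger
qed

section \<open>Norms and traces of elements of orders\<close>

definition quad_norm :: "int \<Rightarrow> rat \<times> rat \<Rightarrow> rat" where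
  "quad_norm D x = (fst x)\<^sup>2 - of_int D * (snd x)\<^sup>2"

lemma quad_norm_mult: "quad_norm D (x \<otimes>\<^bsub>quad_alg D\<^esub> y) = quad_norm D x * quad_norm D y"
  by (simp add: quad_norm_def power2_eq_square algebra_simps)

text \<open>A common denominator of the finitely many additive generators persists under sums and
  negation.\<close>

lemma order_bounded_denominators:
  assumes "is_order (quad_alg D) S"
  obtains n :: nat where "n > 0" "\<And>x. x \<in> S \<Longrightarrow> of_nat n * fst x \<in> \<int> \<and> of_nat n * snd x \<in> \<int>"
proof -
  interpret ring "quad_alg D" by (rule ring_quad_alg)
  obtain B where B: "finite B" "S = generate (add_monoid (quad_alg D)) B"
    using assms by (auto simp: is_order_def)
  have "\<exists>n::nat. n > 0 \<and> (\<forall>x\<in>B. of_nat n * fst x \<in> \<int> \<and> of_nat n * snd x \<in> \<int>)"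
    using B(1)
  proof induction
    case (insert x B)
    then obtain n where n: "n > 0" "\<forall>x\<in>B. of_nat n * fst x \<in> \<int> \<and> of_nat n * snd x \<in> \<int>" by blast
    obtain k where k: "k > 0" "of_nat k * fst x \<in> \<int>" by (rule rat_multiple_Ints)
    obtain l where l: "l > 0" "of_nat l * snd x \<in> \<int>" by (rule rat_multiple_Ints)
    have "of_nat (n * k * l) * fst x \<in> \<int>" "of_nat (n * k * l) * snd x \<in> \<int>"
      using Ints_mult[OF k(2) Ints_of_nat[of "n * l"]] Ints_mult[OF l(2) Ints_of_nat[of "n * k"]]
      by (simp_all add: mult_ac)
    moreover have "of_nat (n * k * l) * fst y \<in> \<int> \<and> of_nat (n * k * l) * snd y \<in> \<int>" if "y \<in> B" for y
      using n(2) that Ints_mult[OF _ Ints_of_nat[of "k * l"], of "of_nat n * fst y"]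
        Ints_mult[OF _ Ints_of_nat[of "k * l"], of "of_nat n * snd y"]
      by (simp add: mult_ac)
    ultimately show ?case
      using n(1) k(1) l(1) by (intro exI[of _ "n * k * l"]) auto
  qed (auto intro: exI[of _ 1])
  then obtain n where n: "n > 0" "\<And>x. x \<in> B \<Longrightarrow> of_nat n * fst x \<in> \<int> \<and> of_nat n * snd x \<in> \<int>"
    by blast
  have "of_nat n * fst x \<in> \<int> \<and> of_nat n * snd x \<in> \<int>"
    if "x \<in> generate (add_monoid (quad_alg D)) B" for x
    using that
  proof induction
    case (inv h)
    moreover have "inv\<^bsub>add_monoid (quad_alg D)\<^esub> h = (- fst h, - snd h)"
      by (simp only: a_inv_def[symmetric] quad_alg_uminus)
    ultimately show ?case using n(2)[of h] by simp
  next
    case (eng h1 h2)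
    then show ?case by (simp add: distrib_left)
  qed (use n in auto)
  with n(1) B(2) that show ?thesis by blast
qed

lemma order_norm_Ints:
  assumes S: "is_order (quad_alg D) S" and "x \<in> S"
  shows "quad_norm D x \<in> \<int>"
proof -
  have sub: "subring S (quad_alg D)" using S by (simp add: is_order_def)
  obtain n :: nat where n: "n > 0" "\<And>x. x \<in> S \<Longrightarrow> of_nat n * fst x \<in> \<int> \<and> of_nat n * snd x \<in> \<int>"
    using S by (rule order_bounded_denominators) blast
  show ?thesis
  proof (rule rat_Ints_if_bounded_powers)
    fix k
    \<comment> \<open>Each power of the norm is the norm of an element of S; as the norm is
      quadratic, n^2 clears its denominator.\<close>
    have "\<exists>y\<in>S. quad_norm D y = quad_norm D x ^ k"
    proof (induction k)
      case 0
      show ?case using subringE(3)[OF sub]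
        by (intro bexI[of _ "(1, 0)"]) (auto simp: quad_norm_def)
    next
      case (Suc k)
      then obtain y where "y \<in> S" "quad_norm D y = quad_norm D x ^ k" by blast
      with subringE(6)[OF sub \<open>x \<in> S\<close>] show ?case
        by (intro bexI[of _ "x \<otimes>\<^bsub>quad_alg D\<^esub> y"]) (auto simp only: quad_norm_mult power_Suc)
    qed
    then obtain y where y: "y \<in> S" "quad_norm D y = quad_norm D x ^ k" by blast
    have "of_int (int n ^ 2) * quad_norm D x ^ k
        = (of_nat n * fst y)\<^sup>2 - of_int D * (of_nat n * snd y)\<^sup>2"
      by (simp only: y(2)[symmetric]) (simp add: quad_norm_def power_mult_distrib algebra_simps)
    also have "\<dots> \<in> \<int>"
      using n(2)[OF y(1)] by (intro Ints_diff Ints_mult[OF Ints_of_int] Ints_power) simp_all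
    finally show "of_int (int n ^ 2) * quad_norm D x ^ k \<in> \<int>" .
  qed (use n(1) in simp)
qed

lemma order_trace_Ints:
  assumes S: "is_order (quad_alg D) S" and "x \<in> S"
  shows "2 * fst x \<in> \<int>"
proof -
  have sub: "subring S (quad_alg D)" using S by (simp add: is_order_def)
  have "(1 + fst x, snd x) \<in> S"
    using subringE(7)[OF sub subringE(3)[OF sub] \<open>x \<in> S\<close>] by simp
  \<comment> \<open>The norm of 1 + x minus the norm of x minus 1 is exactly the trace
    \<open>2 * fst x\<close>.\<close>
  from order_norm_Ints[OF S this] order_norm_Ints[OF S \<open>x \<in> S\<close>]
  have "quad_norm D (1 + fst x, snd x) - quad_norm D x - 1 \<in> \<int>"
    by (intro Ints_diff) auto
  then show ?thesis
    by (simp add: quad_norm_def power2_eq_square algebra_simps)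
qed

text \<open>Elements of any order have integral trace and norm; if these alone force membership in
  O_D, no order is larger.\<close>

lemma fundamental_discriminantI:
  assumes "discriminant D"
    and "\<And>a b :: rat. 2 * a \<in> \<int> \<Longrightarrow> a\<^sup>2 - of_int D * b\<^sup>2 \<in> \<int> \<Longrightarrow> (a, b) \<in> quad_lattice D 1"
  shows "fundamental_discriminant D"
proof -
  have "S \<subseteq> quad_lattice D 1" if "is_order (quad_alg D) S" for S
    using assms(2) order_norm_Ints[OF that] order_trace_Ints[OF that]
    by (auto simp: quad_norm_def)
  moreover have "is_order (quad_alg D) (quad_lattice D 1)"
    using assms(1) by (rule is_order_quad_lattice) simp
  ultimately show ?thesis
    using assms(1)
    by (auto simp: fundamental_discriminant_def is_maximal_order_def quad_order_eq)
qed

section \<open>Maximality of O_D for D squarefree up to a factor 4\<close>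

text \<open>m (2b)^2 = (2a)^2 - 4 (a^2 - m b^2) is an integer, and a squarefree m cannot cancel a
  squared denominator, so 2b is an integer too.\<close>

lemma rat_norm_Ints_cases:
  fixes a b :: rat
  assumes "2 * a \<in> \<int>" "a\<^sup>2 - of_int m * b\<^sup>2 \<in> \<int>" "squarefree m"
  obtains A B where "a = of_int A / 2" "b = of_int B / 2" "4 dvd A\<^sup>2 - m * B\<^sup>2"
proof -
  obtain A where A: "2 * a = of_int A" using assms(1) by (elim Ints_cases)
  obtain n where n: "a\<^sup>2 - of_int m * b\<^sup>2 = of_int n" using assms(2) by (elim Ints_cases)
  have "of_int m * (2 * b)\<^sup>2 = (2 * a)\<^sup>2 - 4 * (a\<^sup>2 - of_int m * b\<^sup>2)"
    by (simp add: power2_eq_square algebra_simps)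
  also have "\<dots> = of_int (A\<^sup>2 - 4 * n)"
    by (simp add: A n)
  finally have eq: "of_int m * (2 * b)\<^sup>2 = (of_int (A\<^sup>2 - 4 * n) :: rat)" .
  then have "2 * b \<in> \<int>"
    by (intro rat_Ints_if_squarefree_mult_square[OF assms(3), of "2 * b"]) (simp only: Ints_of_int)
  then obtain B where B: "2 * b = of_int B" by (elim Ints_cases)
  from eq have "of_int (m * B\<^sup>2) = (of_int (A\<^sup>2 - 4 * n) :: rat)" by (simp add: B)
  then have "m * B\<^sup>2 = A\<^sup>2 - 4 * n" unfolding of_int_eq_iff .
  then have "A\<^sup>2 - m * B\<^sup>2 = 4 * n" by linarith
  then have "4 dvd A\<^sup>2 - m * B\<^sup>2" by (rule dvdI)
  moreover have "a = of_int A / 2" "b = of_int B / 2"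
    using A B by simp_all
  ultimately show ?thesis by (intro that)
qed

lemma int_square_mod_4: "(x :: int)\<^sup>2 mod 4 = x mod 2"
proof (cases "even x")
  case True
  then obtain y where "x = 2 * y" by blast
  then show ?thesis by (simp add: power2_eq_square)
next
  case False
  then obtain y where "x = 2 * y + 1" by (elim oddE)
  then have "x\<^sup>2 = 1 + 4 * (y * y + y)" by (simp add: power2_eq_square algebra_simps)
  then have "x\<^sup>2 mod 4 = 1" by presburger
  with False show ?thesis by (simp add: odd_iff_mod_2_eq_one)
qed

text \<open>Squares mod 4 depend only on parity, so A^2 = D B^2 (mod 4) makes A and B of equal
  parity. As D is odd, A - B D = 2c, and the element is c + B (D + sqrt D)/2.\<close>

lemma fundamental_discriminant_1_mod_4:
  assumes "D > 0" "D mod 4 = 1" "squarefree D"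
  shows "fundamental_discriminant D"
proof (rule fundamental_discriminantI)
  show "discriminant D" using assms by (simp add: discriminant_def cong_def)
  fix a b :: rat
  assume "2 * a \<in> \<int>" "a\<^sup>2 - of_int D * b\<^sup>2 \<in> \<int>"
  then obtain A B where AB: "a = of_int A / 2" "b = of_int B / 2" "4 dvd A\<^sup>2 - D * B\<^sup>2"
    using assms(3) by (rule rat_norm_Ints_cases)
  have "A\<^sup>2 mod 4 = (D mod 4) * (B\<^sup>2 mod 4) mod 4"
    using AB(3) by (simp add: mod_eq_dvd_iff mod_mult_eq)
  then have "A mod 2 = B mod 2" by (simp add: assms(2) int_square_mod_4)
  moreover have "odd D" using assms(2) by presburger
  moreover from calculation(1) have "even A \<longleftrightarrow> even B" by presburger
  ultimately have "even (A - B * D)" by simp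
  then obtain c where c: "A - B * D = 2 * c" by blast
  then have "A = 2 * c + B * D" by simp
  then show "(a, b) \<in> quad_lattice D 1"
    by (intro quad_latticeI[of _ c B]) (simp_all add: AB(1,2) add_divide_distrib)
qed

text \<open>Reading 4m b^2 as m (2b)^2 brings in the squarefree m. An odd B would make A^2 equal to
  2 or 3 mod 4, so B and then A are even.\<close>

lemma fundamental_discriminant_4_mult:
  assumes "m > 0" "m mod 4 = 2 \<or> m mod 4 = 3" "squarefree m"
  shows "fundamental_discriminant (4 * m)"
proof (rule fundamental_discriminantI)
  show "discriminant (4 * m)" using assms by (simp add: discriminant_def cong_def)
  fix a b :: rat
  assume "2 * a \<in> \<int>" "a\<^sup>2 - of_int (4 * m) * b\<^sup>2 \<in> \<int>"
  then have "2 * a \<in> \<int>" "a\<^sup>2 - of_int m * (2 * b)\<^sup>2 \<in> \<int>"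
    by (simp_all add: power_mult_distrib mult_ac)
  then obtain A B where AB: "a = of_int A / 2" "2 * b = of_int B / 2" "4 dvd A\<^sup>2 - m * B\<^sup>2"
    using assms(3) by (rule rat_norm_Ints_cases)
  have "A\<^sup>2 mod 4 = (m mod 4) * (B\<^sup>2 mod 4) mod 4"
    using AB(3) by (simp add: mod_eq_dvd_iff mod_mult_eq)
  then have "A mod 2 = (m mod 4) * (B mod 2) mod 4" by (simp add: int_square_mod_4)
  with assms(2) have "A mod 2 = 2 * (B mod 2) mod 4 \<or> A mod 2 = 3 * (B mod 2) mod 4" by metis
  moreover have "A mod 2 = 0 \<or> A mod 2 = 1" "B mod 2 = 0 \<or> B mod 2 = 1" by auto
  ultimately have "A mod 2 = 0 \<and> B mod 2 = 0" by (elim disjE) simp_all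
  then have "even A \<and> even B" by (simp add: even_iff_mod_2_eq_zero)
  then obtain A' B' where "A = 2 * A'" "B = 2 * B'" by blast
  with AB(1,2) have "a = of_int A'" "b = of_int B' / 2" by simp_all
  then show "(a, b) \<in> quad_lattice (4 * m) 1"
    by (intro quad_latticeI[of _ "A' - 2 * B' * m" B']) simp_all
qed

section \<open>Fundamental discriminants up to 41\<close>

lemma squarefree_int_if_all:
  fixes m :: int
  assumes "m > 0" "m < k\<^sup>2" "k > 0" "\<forall>x\<in>{2..<k}. \<not> x\<^sup>2 dvd m"
  shows "squarefree m"
proof (rule squarefreeI)
  fix x assume x: "x\<^sup>2 dvd m"
  then have "\<bar>x\<bar>\<^sup>2 < k\<^sup>2" using assms(1,2) zdvd_imp_le[of "x\<^sup>2" m] by simp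
  then have "\<bar>x\<bar> < k" using assms(3) by (intro power_less_imp_less_base[of "\<bar>x\<bar>" 2 k]) simp_all
  moreover have "x \<noteq> 0" using x assms(1) by auto
  moreover have "\<bar>x\<bar> \<notin> {2..<k}"
    using assms(4) x by (metis power2_abs)
  ultimately have "\<bar>x\<bar> = 1" by auto
  then show "x dvd 1" by simp
qed

lemma atLeastLessThan_2_7_int: "{2..<7} = {2, 3, 4, 5, 6 :: int}"
  by auto

lemma fundamental_discriminant_classification:
  "{D. fundamental_discriminant D \<and> 1 < D \<and> D \<le> 41 \<and> \<not> [D = 1] (mod 8) \<and> D \<noteq> 21}
     = {5, 8, 12, 13, 24, 28, 29, 37, 40}"  (is "?L = ?R")
proof
  have sqf: "squarefree m" if "m \<in> {2, 3, 5, 6, 7, 10, 13, 29, 37}" for m :: int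
    using that by (intro squarefree_int_if_all[where k = 7]) (auto simp: atLeastLessThan_2_7_int)
  have "fundamental_discriminant D" if "D \<in> {5, 13, 29, 37}" for D
    using that by (intro fundamental_discriminant_1_mod_4 sqf) auto
  moreover have "fundamental_discriminant (4 * m)" if "m \<in> {2, 3, 6, 7, 10}" for m
    using that by (intro fundamental_discriminant_4_mult sqf) auto
  from this[of 2] this[of 3] this[of 6] this[of 7] this[of 10]
  have "fundamental_discriminant D" if "D \<in> {8, 12, 24, 28, 40}" for D
    using that by auto
  ultimately show "?R \<subseteq> ?L"
    by (auto simp: cong_def)
  show "?L \<subseteq> ?R"
  proof
    fix D assume D: "D \<in> ?L"
    then have disc: "D mod 4 = 0 \<or> D mod 4 = 1"
      by (auto simp: fundamental_discriminant_def discriminant_def cong_def)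
    \<comment> \<open>The values that pass the congruences but are missing from the list are 4, 16,
      20, 32 and 36, each 4 times a discriminant.\<close>
    have "D \<noteq> 4 * E" if "E \<in> {1, 4, 5, 8, 9}" for E
    proof -
      have "discriminant E" using that by (auto simp: discriminant_def cong_def)
      with D not_fundamental_discriminant_4_mult[of E] show ?thesis by auto
    qed
    from this[of 1] this[of 4] this[of 5] this[of 8] this[of 9]
    have "D \<notin> {4, 16, 20, 32, 36}" by auto
    moreover have "\<not> D mod 8 = 1" "D \<noteq> 21" "1 < D" "D \<le> 41"
      using D by (auto simp: cong_def)
    moreover define k where "k = D div 4"
    moreover have "D = 4 * k + D mod 4" by (simp add: k_def)
    ultimately have "0 \<le> k" "k \<le> 10" "D = 4 * k \<or> D = 4 * k + 1"
      using disc by linarith+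
    then have "k \<in> set [0..10]" by (simp only: set_upto atLeastAtMost_iff)
    then have "k \<in> {0, 1, 2, 3, 4, 5, 6, 7, 8, 9, 10}" by (simp add: upto.simps del: set_upto)
    with \<open>D = 4 * k \<or> D = 4 * k + 1\<close> \<open>D \<notin> {4, 16, 20, 32, 36}\<close>
      \<open>\<not> D mod 8 = 1\<close> \<open>D \<noteq> 21\<close> \<open>1 < D\<close>
    show "D \<in> ?R" by (elim disjE insertE emptyE) simp_all
  qed
qed

subsection \<open>Comaximality up to powers of an element\<close>

text \<open>Equivalently, x and y generate the unit ideal after m is inverted.\<close>

definition comax :: "'a :: comm_ring_1 \<Rightarrow> 'a \<Rightarrow> 'a \<Rightarrow> bool" where
  "comax m x y \<longleftrightarrow> (\<exists>k u v. u * x + v * y = m ^ k)"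

lemma comaxI: "u * x + v * y = m ^ k \<Longrightarrow> comax m x y"
  unfolding comax_def by blast

lemma comax_commute: "comax m x y \<longleftrightarrow> comax m y x"
  unfolding comax_def by (metis add.commute)

lemma comax_1_right [simp]: "comax m x 1"
  by (rule comaxI[of 0 _ 1 _ _ 0]) simp

text \<open>In the product of the two identities, every term except v v' y z has a factor x.\<close>

lemma comax_mult_right:
  assumes "comax m x y" "comax m x z"
  shows "comax m x (y * z)"
proof -
  obtain k u v where 1: "u * x + v * y = m ^ k" using assms(1) by (auto simp: comax_def)
  obtain l u' v' where 2: "u' * x + v' * z = m ^ l" using assms(2) by (auto simp: comax_def)
  have "(u * (u' * x + v' * z) + v * y * u') * x + (v * v') * (y * z) = m ^ (k + l)"
    by (simp add: power_add 1[symmetric] 2[symmetric] algebra_simps)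
  then show ?thesis by (rule comaxI)
qed

lemma comax_mult_rightD: "comax m x (y * z) \<Longrightarrow> comax m x z"
  unfolding comax_def by (metis mult.assoc)

text \<open>The Euclidean step behind each division with remainder below: the ideal is
  unchanged.\<close>

lemma comax_add_mult_right: "comax m x (q * x + y) \<longleftrightarrow> comax m x y"
proof
  assume "comax m x (q * x + y)"
  then obtain k u v where "u * x + v * (q * x + y) = m ^ k" by (auto simp: comax_def)
  then have "(u + v * q) * x + v * y = m ^ k" by (simp add: algebra_simps)
  then show "comax m x y" by (rule comaxI)
next
  assume "comax m x y"
  then obtain k u v where "u * x + v * y = m ^ k" by (auto simp: comax_def)
  then have "(u - v * q) * x + v * (q * x + y) = m ^ k" by (simp add: algebra_simps)
  then show "comax m x (q * x + y)" by (rule comaxI)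
qed

lemma comax_prod_list_right: "\<forall>y\<in>set ys. comax m x y \<Longrightarrow> comax m x (prod_list ys)"
  by (induction ys) (auto intro: comax_mult_right)

text \<open>Modulo f the derivative of f g is g f', a product of two elements comaximal with f;
  modulo g symmetrically.\<close>

lemma comax_mult_pderiv:
  fixes f g :: "'a :: idom poly"
  assumes "comax m f g" "comax m f (pderiv f)" "comax m g (pderiv g)"
  shows "comax m (f * g) (pderiv (f * g))"
proof -
  have "comax m f (pderiv g * f + g * pderiv f)"
    using comax_mult_right[OF assms(1,2)] by (simp add: comax_add_mult_right)
  moreover have "comax m g (pderiv f * g + f * pderiv g)"
    using comax_mult_right[OF _ assms(3), of f] assms(1)
    by (simp add: comax_add_mult_right comax_commute[of m g f])
  ultimately have "comax m f (pderiv (f * g))" "comax m g (pderiv (f * g))"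
    by (simp_all add: pderiv_mult mult_ac add_ac)
  then show ?thesis
    unfolding comax_commute[of m _ "pderiv (f * g)"] by (rule comax_mult_right)
qed

lemma comax_prod_list_pderiv:
  fixes fs :: "'a :: idom poly list"
  assumes "sorted_wrt (comax m) fs" "\<forall>f\<in>set fs. comax m f (pderiv f)"
  shows "comax m (prod_list fs) (pderiv (prod_list fs))"
  using assms
proof (induction fs)
  case Nil
  show ?case using comax_1_right[of m 0] by (simp add: comax_commute)
next
  case (Cons f fs)
  then show ?case
    by (auto intro!: comax_mult_pderiv comax_prod_list_right)
qed

section \<open>Explicit criteria for factors of degree at most three\<close>

lemma comax_poly_const:
  assumes "u * f + v * g = [:R:]" "R dvd M ^ k"
  shows "comax [:M:] f g"
proof -
  obtain c where "M ^ k = R * c" using assms(2) by blast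
  then have "[:c:] * u * f + [:c:] * v * g = [:M:] ^ k"
    using arg_cong[OF assms(1), of "\<lambda>h. [:c:] * h"]
    by (simp add: poly_const_pow algebra_simps smult_add_right)
  then show ?thesis by (rule comaxI)
qed

text \<open>Division of f by t + b leaves the constant f(-b).\<close>

lemma comax_linear:
  fixes f :: "'a :: idom poly"
  assumes "poly f (- b) dvd M ^ k"
  shows "comax [:M:] [:b, 1:] f"
proof (rule comax_poly_const[OF _ assms])
  let ?s = "synthetic_div f (- b)"
  have "[:b, 1:] * ?s + [:poly f (- b):] = f"
    using synthetic_div_correct'[of "- b" f] by (simp only: minus_minus)
  then have "f - ?s * [:b, 1:] = [:poly f (- b):]"
    by (metis add_diff_cancel_left' mult.commute)
  then show "- ?s * [:b, 1:] + 1 * f = [:poly f (- b):]"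
    by (simp only: mult_minus_left mult_1_left uminus_add_conv_diff)
qed

text \<open>The hypothesis concerns the remainder of \<alpha>^2 (a t^2 + b t + c) on division by
  \<alpha> t + \<beta>; the quotient gives the second cofactor. The leading coefficient a stays
  general to admit the derivative of a cubic.\<close>

lemma comax_quadratic_linear:
  assumes "c * \<alpha>\<^sup>2 - b * \<alpha> * \<beta> + a * \<beta>\<^sup>2 dvd M ^ k"
  shows "comax [:M:] [:c, b, a:] [:\<beta>, \<alpha>:]"
  by (rule comax_poly_const[OF _ assms, of "[:\<alpha>\<^sup>2:]" _ "- [:b * \<alpha> - a * \<beta>, a * \<alpha>:]"])
     (simp add: algebra_simps power2_eq_square)

lemma comax_quadratics:
  assumes "b * (c - a)\<^sup>2 - a * (c - a) * (d - b) + (d - b)\<^sup>2 dvd M ^ k"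
  shows "comax [:M:] [:b, a, 1:] [:d, c, 1:]"
proof -
  have "[:d, c, 1:] = 1 * [:b, a, 1:] + [:d - b, c - a:]" by simp
  then show ?thesis
    using comax_quadratic_linear[of b "c - a" a "d - b" 1 M k] assms
    by (simp only: comax_add_mult_right) simp
qed

text \<open>\<alpha> t + \<beta> is the remainder of the cubic modulo the quadratic, with quotient t
  + c - a.\<close>

lemma comax_quadratic_cubic:
  fixes a b c d e :: "'a :: idom"
  defines "\<alpha> \<equiv> d - b - (c - a) * a" and "\<beta> \<equiv> e - (c - a) * b"
  assumes "b * \<alpha>\<^sup>2 - a * \<alpha> * \<beta> + \<beta>\<^sup>2 dvd M ^ k"
  shows "comax [:M:] [:b, a, 1:] [:e, d, c, 1:]"
proof -
  have "[:e, d, c, 1:] = [:c - a, 1:] * [:b, a, 1:] + [:\<beta>, \<alpha>:]"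
    by (simp add: \<alpha>_def \<beta>_def algebra_simps)
  then show ?thesis
    using comax_quadratic_linear[of b \<alpha> a \<beta> 1 M k] assms(3)
    by (simp only: comax_add_mult_right) simp
qed

text \<open>For the quadratic and 2 t + a the previous criterion evaluates to 4b - a^2, minus the
  discriminant.\<close>

lemma comax_quadratic_pderiv:
  fixes a b :: "'a :: idom"
  assumes "4 * b - a\<^sup>2 dvd M ^ k"
  shows "comax [:M:] [:b, a, 1:] (pderiv [:b, a, 1:])"
  using comax_quadratic_linear[of b 2 a a 1 M k] assms
  by (simp add: pderiv_pCons power2_eq_square mult_ac)

text \<open>\<alpha> t + \<beta> is the remainder of 9 f modulo f'; the 9 avoids denominators and is
  dropped at the end. The tested value is therefore -9 times the discriminant, harmless below since
  3 divides \<open>N 37\<close> and \<open>N 40\<close>, the cases with a cubic factor.\<close>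

lemma comax_cubic_pderiv:
  fixes a b c :: "'a :: idom"
  defines "\<alpha> \<equiv> 6 * b - 2 * a\<^sup>2" and "\<beta> \<equiv> 9 * c - a * b"
  assumes "b * \<alpha>\<^sup>2 - 2 * a * \<alpha> * \<beta> + 3 * \<beta>\<^sup>2 dvd M ^ k"
  shows "comax [:M:] [:c, b, a, 1:] (pderiv [:c, b, a, 1:])"
proof -
  have f': "pderiv [:c, b, a, 1:] = [:b, 2 * a, 3:]"
    by (simp add: pderiv_pCons)
  have "[:9:] * [:c, b, a, 1:] = [:a, 3:] * [:b, 2 * a, 3:] + [:\<beta>, \<alpha>:]"
    by (simp add: \<alpha>_def \<beta>_def algebra_simps power2_eq_square)
  moreover have "comax [:M:] [:b, 2 * a, 3:] [:\<beta>, \<alpha>:]"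
    using assms(3) by (rule comax_quadratic_linear)
  ultimately have "comax [:M:] [:b, 2 * a, 3:] ([:9:] * [:c, b, a, 1:])"
    by (simp only: comax_add_mult_right)
  then show ?thesis
    unfolding f' comax_commute[of _ "[:c, b, a, 1:]"] by (rule comax_mult_rightD)
qed

section \<open>Resultants from Bezout identities\<close>

text \<open>Multiply the identity by t^i and reduce the cofactor of g modulo f; then u f = c t^i - v
  g has degree below deg f + deg g, which bounds u. Bounds are phrased by vanishing coefficients to
  cover degree g = 0, where u must be 0.\<close>

lemma bounded_degree_Bezout:
  fixes f g :: "'a :: idom poly"
  assumes monic: "lead_coeff f = 1" and bez: "u0 * f + v0 * g = [:c:]"
    and i: "i < degree f + degree g"
  obtains u v where "u * f + v * g = monom c i"
    "\<And>l. l \<ge> degree g \<Longrightarrow> coeff u l = 0" "\<And>l. l \<ge> degree f \<Longrightarrow> coeff v l = 0"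
proof -
  have f: "f \<noteq> 0" using monic by auto
  \<comment> \<open>For monic f, pseudo-division is ordinary division with remainder, over any
    integral domain.\<close>
  obtain q r where qr: "pseudo_divmod (monom 1 i * v0) f = (q, r)" by force
  have w: "monom 1 i * v0 = f * q + r" and r: "r = 0 \<or> degree r < degree f"
    using pseudo_divmod[OF f qr] monic by simp_all
  define u where "u = monom 1 i * u0 + q * g"
  have "u * f + r * g = monom 1 i * (u0 * f) + (f * q + r) * g"
    by (simp add: u_def algebra_simps)
  also have "\<dots> = monom 1 i * (u0 * f + v0 * g)"
    unfolding w[symmetric] by (simp only: algebra_simps)
  also have "\<dots> = monom c i"
    by (simp add: bez mult_monom flip: monom_0)
  finally have eq: "u * f + r * g = monom c i" .
  have "degree (r * g) < degree f + degree g"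
    using r i degree_mult_le[of r g] by auto
  moreover have "degree (monom c i) < degree f + degree g"
    using i degree_monom_le[of c i] by simp
  moreover have "u * f = monom c i - r * g"
    using eq by (simp add: algebra_simps)
  ultimately have "degree (u * f) < degree f + degree g"
    by (simp add: degree_diff_less)
  then have "u = 0 \<or> degree u < degree g"
    using f by (cases "u = 0") (simp_all add: degree_mult_eq)
  with r eq show ?thesis
    by (intro that[of u r]) (auto intro: coeff_eq_0)
qed

lemma sum_coeff_monom_mult:
  fixes p f :: "'a :: comm_ring_1 poly"
  assumes "\<And>l. l \<ge> n \<Longrightarrow> coeff p l = 0"
  shows "(\<Sum>i<n. coeff p i * coeff (monom 1 i * f) l) = coeff (p * f) l"
proof -
  have "p = (\<Sum>i<n. monom (coeff p i) i)"
    by (intro poly_eqI) (use assms in \<open>auto simp: coeff_sum not_less\<close>)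
  then have "p * f = (\<Sum>i<n. monom (coeff p i) i * f)"
    by (metis sum_distrib_right)
  also have "\<dots> = (\<Sum>i<n. smult (coeff p i) (monom 1 i * f))"
    by (simp add: smult_monom flip: mult_smult_left)
  finally show ?thesis by (simp add: coeff_sum)
qed

lemma coeff_monom_1_mult:
  "coeff (monom (1 :: 'a :: comm_ring_1) i * f) l = (if i \<le> l then coeff f (l - i) else 0)"
  by (simp add: coeff_monom_mult)

text \<open>Row i < n of the Sylvester matrix lists t^(n-1-i) f and row n + i lists t^(m-1-i) g,
  with column j holding degree m+n-1-j. Hence a row vector of coefficients of u and v produces u f +
  v g.\<close>

lemma sylvester_row_combination:
  fixes f g u v :: "'a :: comm_ring_1 poly"
  defines "m \<equiv> degree f" and "n \<equiv> degree g"
  assumes u: "\<And>l. l \<ge> n \<Longrightarrow> coeff u l = 0" and v: "\<And>l. l \<ge> m \<Longrightarrow> coeff v l = 0"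
    and j: "j < m + n"
  shows "(\<Sum>i<m + n. (if i < n then coeff u (n - 1 - i) else coeff v (m + n - 1 - i)) *
            sylvester_mat f g $$ (i, j)) = coeff (u * f + v * g) (m + n - 1 - j)"
proof -
  have upper: "sylvester_mat f g $$ (i, j) = coeff (monom 1 (n - 1 - i) * f) (m + n - 1 - j)"
    if "i < n" for i
  proof -
    have "sylvester_mat f g $$ (i, j) =
        (if i \<le> j \<and> j - i \<le> m then coeff f (m + i - j) else 0)"
      using that j unfolding m_def n_def by (subst sylvester_index_mat) auto
    moreover have "coeff f (m + i - j) = 0" if "i > j"
      using that by (intro coeff_eq_0) (simp add: m_def)
    moreover have "n - 1 - i \<le> m + n - 1 - j \<longleftrightarrow> j \<le> m + i"
      using that j by auto
    moreover have "m + n - 1 - j - (n - 1 - i) = m + i - j"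
      using that by auto
    ultimately show ?thesis by (auto simp: coeff_monom_1_mult)
  qed
  have lower: "sylvester_mat f g $$ (n + i, j) = coeff (monom 1 (m - 1 - i) * g) (m + n - 1 - j)"
    if "i < m" for i
  proof -
    have "sylvester_mat f g $$ (n + i, j) =
        (if i \<le> j \<and> j \<le> n + i then coeff g (n + i - j) else 0)"
      using that j unfolding m_def n_def by (subst sylvester_index_mat) auto
    moreover have "coeff g (n + i - j) = 0" if "i > j"
      using that by (intro coeff_eq_0) (simp add: n_def)
    moreover have "m - 1 - i \<le> m + n - 1 - j \<longleftrightarrow> j \<le> n + i"
      using that j by auto
    moreover have "m + n - 1 - j - (m - 1 - i) = n + i - j"
      using that by auto
    ultimately show ?thesis by (auto simp: coeff_monom_1_mult)
  qed
  let ?h = "\<lambda>i. (if i < n then coeff u (n - 1 - i) else coeff v (m + n - 1 - i)) *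
            sylvester_mat f g $$ (i, j)"
  have "(\<Sum>i<m + n. ?h i) = (\<Sum>i<n. ?h i) + (\<Sum>i<m. ?h (n + i))"
    by (simp add: add.commute[of m n] lessThan_atLeast0 sum.atLeastLessThan_concat[of 0 n "n + m", symmetric]
        sum.atLeastLessThan_shift_0[of _ n "n + m"] comp_def)
  also have "(\<Sum>i<n. ?h i) = (\<Sum>i<n. coeff u (n - 1 - i) * coeff (monom 1 (n - 1 - i) * f) (m + n - 1 - j))"
    by (intro sum.cong) (simp_all add: upper)
  also have "\<dots> = (\<Sum>i<n. coeff u i * coeff (monom 1 i * f) (m + n - 1 - j))"
    by (subst sum.nat_diff_reindex[symmetric]) simp
  also have "(\<Sum>i<m. ?h (n + i)) = (\<Sum>i<m. coeff v (m - 1 - i) *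
      coeff (monom 1 (m - 1 - i) * g) (m + n - 1 - j))"
    by (intro sum.cong) (auto simp: lower intro!: arg_cong2[of _ _ _ _ times] arg_cong[of _ _ "coeff v"])
  also have "\<dots> = (\<Sum>i<m. coeff v i * coeff (monom 1 i * g) (m + n - 1 - j))"
    by (subst sum.nat_diff_reindex[symmetric]) simp
  finally show ?thesis
    by (simp add: sum_coeff_monom_mult u v)
qed

lemma resultant_dvd_power_if_comax:
  fixes f g :: "'a :: idom poly"
  assumes monic: "lead_coeff f = 1" and comax: "comax [:M:] f g"
  shows "\<exists>k. resultant f g dvd M ^ k"
proof -
  let ?m = "degree f" and ?n = "degree g"
  obtain k u0 v0 where "u0 * f + v0 * g = [:M:] ^ k" using comax by (auto simp: comax_def)
  then have bez: "u0 * f + v0 * g = [:M ^ k:]" by (simp add: poly_const_pow)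
  have "\<forall>i\<in>{..<?m + ?n}. \<exists>p. fst p * f + snd p * g = monom (M ^ k) i \<and>
      (\<forall>l\<ge>?n. coeff (fst p) l = 0) \<and> (\<forall>l\<ge>?m. coeff (snd p) l = 0)"
  proof
    fix i assume "i \<in> {..<?m + ?n}"
    then have "i < ?m + ?n" by simp
    from bounded_degree_Bezout[OF monic bez this] show "\<exists>p. fst p * f + snd p * g = monom (M ^ k) i \<and>
        (\<forall>l\<ge>?n. coeff (fst p) l = 0) \<and> (\<forall>l\<ge>?m. coeff (snd p) l = 0)"
      by (metis fst_conv snd_conv)
  qed
  from bchoice[OF this] obtain P where P: "\<forall>i\<in>{..<?m + ?n}.
      fst (P i) * f + snd (P i) * g = monom (M ^ k) i \<and>
      (\<forall>l\<ge>?n. coeff (fst (P i)) l = 0) \<and> (\<forall>l\<ge>?m. coeff (snd (P i)) l = 0)" ..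
  define U V where "U i = fst (P i)" and "V i = snd (P i)" for i
  have UV: "U i * f + V i * g = monom (M ^ k) i"
      "\<And>l. l \<ge> ?n \<Longrightarrow> coeff (U i) l = 0" "\<And>l. l \<ge> ?m \<Longrightarrow> coeff (V i) l = 0"
    if "i < ?m + ?n" for i
    using P that by (auto simp: U_def V_def)
  \<comment> \<open>Row r serves the target of degree \<open>?m + ?n - 1 - r\<close>; this reversal
    matches the descending columns, so the product is scalar and not antidiagonal.\<close>
  define W where "W = mat (?m + ?n) (?m + ?n) (\<lambda>(r, i).
    if i < ?n then coeff (U (?m + ?n - 1 - r)) (?n - 1 - i) else coeff (V (?m + ?n - 1 - r)) (?m + ?n - 1 - i))"
  have W: "W \<in> carrier_mat (?m + ?n) (?m + ?n)" by (simp add: W_def)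
  have "W * sylvester_mat f g = M ^ k \<cdot>\<^sub>m 1\<^sub>m (?m + ?n)"
  proof (rule eq_matI)
    fix r j assume "r < dim_row (M ^ k \<cdot>\<^sub>m 1\<^sub>m (?m + ?n))" "j < dim_col (M ^ k \<cdot>\<^sub>m 1\<^sub>m (?m + ?n))"
    then have rj: "r < ?m + ?n" "j < ?m + ?n" by auto
    then have lt: "?m + ?n - 1 - r < ?m + ?n" by simp
    have "(W * sylvester_mat f g) $$ (r, j) = (\<Sum>i<?m + ?n. W $$ (r, i) * sylvester_mat f g $$ (i, j))"
      using rj W by (simp add: scalar_prod_def lessThan_atLeast0)
    also have "\<dots> = (\<Sum>i<?m + ?n.
        (if i < ?n then coeff (U (?m + ?n - 1 - r)) (?n - 1 - i) else coeff (V (?m + ?n - 1 - r)) (?m + ?n - 1 - i)) *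
        sylvester_mat f g $$ (i, j))"
      using rj by (intro sum.cong) (simp_all add: W_def)
    also have "\<dots> = coeff (monom (M ^ k) (?m + ?n - 1 - r)) (?m + ?n - 1 - j)"
      using rj(2) UV(2,3)[OF lt] by (simp only: sylvester_row_combination UV(1)[OF lt])
    also have "\<dots> = (M ^ k \<cdot>\<^sub>m 1\<^sub>m (?m + ?n)) $$ (r, j)"
      using rj by auto
    finally show "(W * sylvester_mat f g) $$ (r, j) = (M ^ k \<cdot>\<^sub>m 1\<^sub>m (?m + ?n)) $$ (r, j)" .
  qed (use W in auto)
  then have "det W * det (sylvester_mat f g) = (M ^ k) ^ (?m + ?n)"
    using det_mult[OF W sylvester_carrier_mat] by simp
  then have "resultant f g dvd M ^ (k * (?m + ?n))"
    unfolding resultant_def power_mult by (metis dvd_triv_right)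
  then show ?thesis by blast
qed

lemma prime_dvd_poly_discriminant:
  assumes "lead_coeff f = 1" "comax [:M:] f (pderiv f)" "prime p" "p dvd poly_discriminant f"
  shows "p dvd M"
proof -
  obtain k where k: "resultant f (pderiv f) dvd M ^ k"
    using resultant_dvd_power_if_comax[OF assms(1,2)] by blast
  \<comment> \<open>For monic f the discriminant is the resultant up to sign.\<close>
  have "poly_discriminant f dvd resultant f (pderiv f)"
    using assms(1) by (simp add: poly_discriminant_def minus_one_power_iff)
  with k assms(4) have "p dvd M ^ k" by (blast intro: dvd_trans)
  with assms(3) show ?thesis by (rule prime_dvd_power)
qed

section \<open>Discriminants of the nine cuspidal polynomials\<close>

lemma monic_prod_list:
  "\<forall>f\<in>set fs. lead_coeff f = 1 \<Longrightarrow> lead_coeff (prod_list fs :: 'a :: idom poly) = 1"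
  by (induction fs) (auto simp: lead_coeff_mult)

lemma cuspidal_polyI:
  assumes "cuspidal_poly D = map_poly of_int (prod_list fs)" "\<forall>f\<in>set fs. lead_coeff f = 1"
    "sorted_wrt (comax [:N D:]) fs" "\<forall>f\<in>set fs. comax [:N D:] f (pderiv f)"
  shows "\<exists>c :: int poly. cuspidal_poly D = map_poly of_int c \<and>
           (\<forall>p :: int. prime p \<and> p dvd poly_discriminant c \<longrightarrow> p dvd N D)"
  using assms prime_dvd_poly_discriminant[OF monic_prod_list comax_prod_list_pderiv] by blast

text \<open>e^2 < 49 leaves e <= 6; conditional factors over a fixed set let \<open>simp\<close>
  compute the value.\<close>

lemma N_eq:
  assumes "D \<le> 49"
  shows "N D = 2 * D * (\<Prod>e\<in>{1, 2, 3, 4, 5, 6}. if [e = D] (mod 2) \<and> e\<^sup>2 < D then (D - e\<^sup>2) div 4 else 1)"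
proof -
  have "e \<in> {1, 2, 3, 4, 5, 6}" if "e > 0" "e\<^sup>2 < D" for e
  proof -
    have "e < 7" using that assms by (intro power_less_imp_less_base[of e 2 7]) auto
    with that(1) show ?thesis by auto
  qed
  then have "{e. e > 0 \<and> [e = D] (mod 2) \<and> e\<^sup>2 < D} =
      {e \<in> {1, 2, 3, 4, 5, 6}. [e = D] (mod 2) \<and> e\<^sup>2 < D}"
    by auto
  then show ?thesis
    unfolding N_def by (simp only: prod.inter_filter finite.intros)
qed

text \<open>Each rule leaves a divisibility between numerals once k is fixed, any large enough
  exponent being suitable. The factor lists below are sorted by degree because the rules take the
  factor of smaller degree first.\<close>

lemmas comax_resultant_rules =
  comax_linear comax_quadratics comax_quadratic_cubic

lemma comax_linear_pderiv: "comax m [:b, 1:] (pderiv [:b, 1 :: 'a :: idom:])"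
  using comax_1_right[of m "[:b, 1:]"] by (simp add: pderiv_pCons one_pCons)

lemmas comax_pderiv_rules =
  comax_quadratic_pderiv comax_cubic_pderiv

lemma cuspidal_poly_5:
  "\<exists>c :: int poly. cuspidal_poly 5 = map_poly of_int c \<and>
     (\<forall>p :: int. prime p \<and> p dvd poly_discriminant c \<longrightarrow> p dvd N 5)"
proof (rule cuspidal_polyI)
  let ?fs = "[[:-4, 1:]] :: int poly list"
  have N: "N 5 = 10" by (simp add: N_eq cong_def)
  show "cuspidal_poly 5 = map_poly of_int (prod_list ?fs)"
    by (simp add: cuspidal_poly_def Let_def numeral_poly power2_eq_square power3_eq_cube)
  show "sorted_wrt (comax [:N 5:]) ?fs"
    unfolding N by (simp add: comax_resultant_rules[where k = 1])
  show "\<forall>f\<in>set ?fs. comax [:N 5:] f (pderiv f)"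
    unfolding N by (simp add: comax_linear_pderiv comax_pderiv_rules[where k = 1])
qed simp

lemma cuspidal_poly_8:
  "\<exists>c :: int poly. cuspidal_poly 8 = map_poly of_int c \<and>
     (\<forall>p :: int. prime p \<and> p dvd poly_discriminant c \<longrightarrow> p dvd N 8)"
proof (rule cuspidal_polyI)
  let ?fs = "[[:0, 1:], [:1, 1:]] :: int poly list"
  have N: "N 8 = 16" by (simp add: N_eq cong_def)
  show "cuspidal_poly 8 = map_poly of_int (prod_list ?fs)"
    by (simp add: cuspidal_poly_def Let_def one_pCons numeral_poly power2_eq_square power3_eq_cube)
  show "sorted_wrt (comax [:N 8:]) ?fs"
    unfolding N by (simp add: comax_resultant_rules[where k = 1])
  show "\<forall>f\<in>set ?fs. comax [:N 8:] f (pderiv f)"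
    unfolding N by (simp add: comax_linear_pderiv comax_pderiv_rules[where k = 1])
qed simp

lemma cuspidal_poly_12:
  "\<exists>c :: int poly. cuspidal_poly 12 = map_poly of_int c \<and>
     (\<forall>p :: int. prime p \<and> p dvd poly_discriminant c \<longrightarrow> p dvd N 12)"
proof (rule cuspidal_polyI)
  let ?fs = "[[:13, 10, 1:]] :: int poly list"
  have N: "N 12 = 48" by (simp add: N_eq cong_def)
  show "cuspidal_poly 12 = map_poly of_int (prod_list ?fs)"
    by (simp add: cuspidal_poly_def Let_def numeral_poly power2_eq_square power3_eq_cube)
  show "sorted_wrt (comax [:N 12:]) ?fs"
    unfolding N by (simp add: comax_resultant_rules[where k = 1])
  show "\<forall>f\<in>set ?fs. comax [:N 12:] f (pderiv f)"
    unfolding N by (simp add: comax_linear_pderiv comax_pderiv_rules[where k = 1])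
qed simp

lemma cuspidal_poly_13:
  "\<exists>c :: int poly. cuspidal_poly 13 = map_poly of_int c \<and>
     (\<forall>p :: int. prime p \<and> p dvd poly_discriminant c \<longrightarrow> p dvd N 13)"
proof (rule cuspidal_polyI)
  let ?fs = "[[:0, 1:], [:-3, -14, 1:]] :: int poly list"
  have N: "N 13 = 78" by (simp add: N_eq cong_def)
  show "cuspidal_poly 13 = map_poly of_int (prod_list ?fs)"
    by (simp add: cuspidal_poly_def Let_def numeral_poly power2_eq_square power3_eq_cube)
  show "sorted_wrt (comax [:N 13:]) ?fs"
    unfolding N by (simp add: comax_resultant_rules[where k = 4])
  \<comment> \<open>t^2 - 14 t - 3 has discriminant 2^4 * 13, and 78 contains 2 only once, hence k =
    4.\<close>
  show "\<forall>f\<in>set ?fs. comax [:N 13:] f (pderiv f)"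
    unfolding N by (simp add: comax_linear_pderiv comax_pderiv_rules[where k = 4])
qed simp

lemma cuspidal_poly_24:
  "\<exists>c :: int poly. cuspidal_poly 24 = map_poly of_int c \<and>
     (\<forall>p :: int. prime p \<and> p dvd poly_discriminant c \<longrightarrow> p dvd N 24)"
proof (rule cuspidal_polyI)
  let ?fs = "[[:0, 1:], [:-16, 1:], [:-6, 0, 1:], [:-72, -24, 1:]] :: int poly list"
  have N: "N 24 = 480" by (simp add: N_eq cong_def)
  show "cuspidal_poly 24 = map_poly of_int (prod_list ?fs)"
    by (simp add: cuspidal_poly_def Let_def numeral_poly power2_eq_square power3_eq_cube)
  \<comment> \<open>t^2 - 6 takes the value 2 * 5^3 at 16, and 480 contains 5 only once, hence k =
    3.\<close>
  show "sorted_wrt (comax [:N 24:]) ?fs"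
    unfolding N by (simp add: comax_resultant_rules[where k = 3])
  show "\<forall>f\<in>set ?fs. comax [:N 24:] f (pderiv f)"
    unfolding N by (simp add: comax_linear_pderiv comax_pderiv_rules[where k = 3])
qed simp

lemma cuspidal_poly_28:
  "\<exists>c :: int poly. cuspidal_poly 28 = map_poly of_int c \<and>
     (\<forall>p :: int. prime p \<and> p dvd poly_discriminant c \<longrightarrow> p dvd N 28)"
proof (rule cuspidal_polyI)
  let ?fs = "[[:-423, -24, 1:], [:-63, 0, 1:], [:21, 14, 1:]] :: int poly list"
  have N: "N 28 = 1008" by (simp add: N_eq cong_def)
  show "cuspidal_poly 28 = map_poly of_int (prod_list ?fs)"
    by (simp add: cuspidal_poly_def Let_def numeral_poly power2_eq_square power3_eq_cube)
  \<comment> \<open>The first and third factors give -2^2 * 3^7, and 1008 contains 3^2, hence k =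
    4.\<close>
  show "sorted_wrt (comax [:N 28:]) ?fs"
    unfolding N by (simp add: comax_resultant_rules[where k = 4])
  show "\<forall>f\<in>set ?fs. comax [:N 28:] f (pderiv f)"
    unfolding N by (simp add: comax_linear_pderiv comax_pderiv_rules[where k = 4])
qed simp

lemma cuspidal_poly_29:
  "\<exists>c :: int poly. cuspidal_poly 29 = map_poly of_int c \<and>
     (\<forall>p :: int. prime p \<and> p dvd poly_discriminant c \<longrightarrow> p dvd N 29)"
proof (rule cuspidal_polyI)
  let ?fs = "[[:0, 1:], [:145, -174, 1:], [:-3625, 145, 1:]] :: int poly list"
  have N: "N 29 = 2030" by (simp add: N_eq cong_def)
  show "cuspidal_poly 29 = map_poly of_int (prod_list ?fs)"
    by (simp add: cuspidal_poly_def Let_def numeral_poly power2_eq_square power3_eq_cube)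
  show "sorted_wrt (comax [:N 29:]) ?fs"
    unfolding N by (simp add: comax_resultant_rules[where k = 10])
  \<comment> \<open>t^2 - 174 t + 145 has discriminant 2^10 * 29, and 2030 contains 2 only once,
    hence k = 10.\<close>
  show "\<forall>f\<in>set ?fs. comax [:N 29:] f (pderiv f)"
    unfolding N by (simp add: comax_linear_pderiv comax_pderiv_rules[where k = 10])
qed simp

lemma cuspidal_poly_37:
  "\<exists>c :: int poly. cuspidal_poly 37 = map_poly of_int c \<and>
     (\<forall>p :: int. prime p \<and> p dvd poly_discriminant c \<longrightarrow> p dvd N 37)"
proof (rule cuspidal_polyI)
  let ?fs = "[[:-2368, 0, 1:], [:-1332, 0, 1:], [:1221, 74, 1:], [:-114108, -2220, 51, 1:]] :: int poly list"
  have N: "N 37 = 13986" by (simp add: N_eq cong_def)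
  show "cuspidal_poly 37 = map_poly of_int (prod_list ?fs)"
    by (simp add: cuspidal_poly_def Let_def numeral_poly power2_eq_square power3_eq_cube)
  show "sorted_wrt (comax [:N 37:]) ?fs"
    unfolding N by (simp add: comax_resultant_rules[where k = 8])
  \<comment> \<open>t^2 - 2368 has discriminant 2^8 * 37, and 13986 contains 2 only once, hence k =
    8.\<close>
  show "\<forall>f\<in>set ?fs. comax [:N 37:] f (pderiv f)"
    unfolding N by (simp add: comax_linear_pderiv comax_pderiv_rules[where k = 8])
qed simp

lemma cuspidal_poly_40:
  "\<exists>c :: int poly. cuspidal_poly 40 = map_poly of_int c \<and>
     (\<forall>p :: int. prime p \<and> p dvd poly_discriminant c \<longrightarrow> p dvd N 40)"
proof (rule cuspidal_polyI)
  let ?fs = "[[:0, 1:], [:81, 1:], [:2025, 110, 1:], [:-10935, 270, 1:],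
      [:18225, 630, 1:], [:164025, 10935, 351, 1:]] :: int poly list"
  have N: "N 40 = 4320" by (simp add: N_eq cong_def)
  show "cuspidal_poly 40 = map_poly of_int (prod_list ?fs)"
    by (simp add: cuspidal_poly_def Let_def numeral_poly power2_eq_square power3_eq_cube)
  show "sorted_wrt (comax [:N 40:]) ?fs"
    unfolding N by (simp add: comax_resultant_rules[where k = 7])
  \<comment> \<open>The value tested for the cubic is 2^9 * 3^19 * 5^3, and 4320 contains 3^3, hence
    k = 7.\<close>
  show "\<forall>f\<in>set ?fs. comax [:N 40:] f (pderiv f)"
    unfolding N by (simp add: comax_linear_pderiv comax_pderiv_rules[where k = 7])
qed simp

lemma cuspidal_poly_discriminant:
  assumes "D \<in> {5, 8, 12, 13, 24, 28, 29, 37, 40}"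
  shows "\<exists>c :: int poly. cuspidal_poly D = map_poly of_int c \<and>
           (\<forall>p :: int. prime p \<and> p dvd poly_discriminant c \<longrightarrow> p dvd N D)"
  using assms cuspidal_poly_5 cuspidal_poly_8 cuspidal_poly_12 cuspidal_poly_13 cuspidal_poly_24
    cuspidal_poly_28 cuspidal_poly_29 cuspidal_poly_37 cuspidal_poly_40
  by (elim insertE) simp_all

theorem theorem1p7:
  shows "{D. fundamental_discriminant D \<and> 1 < D \<and> D \<le> 41 \<and> \<not> [D = 1] (mod 8) \<and> D \<noteq> 21}
           = {5, 8, 12, 13, 24, 28, 29, 37, 40}
       \<and> (\<forall>D. fundamental_discriminant D \<and> 1 < D \<and> D \<le> 41 \<and> \<not> [D = 1] (mod 8) \<and> D \<noteq> 21 \<longrightarrow>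
            (\<exists>c :: int poly. cuspidal_poly D = map_poly of_int c \<and>
               (\<forall>p :: int. prime p \<and> p dvd poly_discriminant c \<longrightarrow> p dvd N D)))"
  using fundamental_discriminant_classification cuspidal_poly_discriminant by blast

end
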